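(* There exists an absolute constant $c_2>0$ such that the following holds. Let $r=r(n)>0$ satisfy $r^5 > c_2 \frac{\log n}{n}$. Then asymptotically almost surely (i.e., with probability tending to $1$ as $n\to\infty$) the random geometric graph $\mathcal{G}_2(n,r)$ has cop number $c(\mathcal{G}_2(n,r))=1$.
   Context: The game of Cops and Robbers is played on a finite simple undirected graph $G$ by $k\ge 1$ cops and one robber. The cops first occupy any $k$ vertices (several cops may share a vertex); then the robber chooses a vertex; then the cops and the robber move in alternate rounds, where in a move each player either stays at its current vertex or moves along an edge to an adjacent vertex. Both sides always know all current positions. The cops win if at some point a cop occupies the same vertex as the robber; otherwise the robber wins. The cop number $c(G)$ is the minimum $k$ such that $k$ cops have a winning strategy on $G$. The random geometric graph $\mathcal{G}_d(n,r)$ has vertex set $\{1,\dots,n\}$; the $n$ vertices are assigned points chosen independently and uniformly at random from $[0,1]^d$, and two vertices are adjacent if and only if the Euclidean distance between their points is at most $r$. Here $r=r(n)$ may depend on $n$, and asymptotics are as $n\to\infty$. *)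

theory Defs
  imports "HOL-Probability.Probability"
begin

text \<open>Cops and Robbers on a graph given by a symmetric irreflexive edge relation E
  (all edges inside the vertex set).  A state is (cops_to_move, list of cop positions,
  robber position).  cops_win_from E t cs r holds iff the cops can force a capture
  from this state (least fixed point = attractor of the reachability game).\<close>

inductive cops_win_from :: "('a \<Rightarrow> 'a \<Rightarrow> bool) \<Rightarrow> bool \<Rightarrow> 'a list \<Rightarrow> 'a \<Rightarrow> bool"
  for E :: "'a \<Rightarrow> 'a \<Rightarrow> bool" where
  caught: "r \<in> set cs \<Longrightarrow> cops_win_from E t cs r"
| cops_move: "list_all2 (\<lambda>c c'. c' = c \<or> E c c') cs cs' \<Longrightarrow> cops_win_from E False cs' r
     \<Longrightarrow> cops_win_from E True cs r"
| robber_move: "(\<And>r'. r' = r \<or> E r r' \<Longrightarrow> cops_win_from E True cs r')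
     \<Longrightarrow> cops_win_from E False cs r"

definition k_cops_win :: "'a set \<Rightarrow> ('a \<Rightarrow> 'a \<Rightarrow> bool) \<Rightarrow> nat \<Rightarrow> bool" where
  "k_cops_win V E k \<longleftrightarrow>
     (\<exists>cs. length cs = k \<and> set cs \<subseteq> V \<and> (\<forall>r\<in>V. cops_win_from E True cs r))"

definition cop_number :: "'a set \<Rightarrow> ('a \<Rightarrow> 'a \<Rightarrow> bool) \<Rightarrow> nat" where
  "cop_number V E = (LEAST k. k \<ge> 1 \<and> k_cops_win V E k)"

definition rgg_adj :: "nat \<Rightarrow> real \<Rightarrow> (nat \<Rightarrow> real^2) \<Rightarrow> nat \<Rightarrow> nat \<Rightarrow> bool" where
  "rgg_adj n r p i j \<longleftrightarrow> i < n \<and> j < n \<and> i \<noteq> j \<and> dist (p i) (p j) \<le> r"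

definition unit_square :: "(real^2) set" where
  "unit_square = {x. \<forall>i. 0 \<le> x $ i \<and> x $ i \<le> 1}"

definition rgg_space :: "nat \<Rightarrow> (nat \<Rightarrow> real^2) measure" where
  "rgg_space n = PiM {..<n} (\<lambda>_. uniform_measure lborel unit_square)"

end

theory Submission
  imports Defs
begin

text \<open>Remove the vertices in order of decreasing distance to the centre \<open>z\<close> of the square. When
  \<open>v\<close> is next, at distance \<open>\<rho>\<close> from \<open>z\<close>, its remaining neighbours lie in the lens formed by the
  disc of radius \<open>r\<close> around \<open>v\<close> and the disc of radius \<open>\<rho>\<close> around \<open>z\<close>. Every point reached from \<open>v\<close>
  by moving about \<open>r\<^sup>2\<close> towards \<open>z\<close> and at most about \<open>r\<^sup>3\<close> sideways is within \<open>r\<close> of the entire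
  lens, so a vertex there dominates \<open>v\<close>. These points fill a rectangle of area at least
  \<open>r\<^sup>5 / 200\<close>, so a union bound shows that a.a.s. every \<open>v\<close> with \<open>2 * \<rho> > r\<close> is dominated. Once
  \<open>2 * \<rho> \<le> r\<close>, the remaining graph is complete. Hence the graph is dismantlable, and one cop wins.\<close>

subsection \<open>Dismantling a graph\<close>

text \<open>The vertex \<open>v\<close> is dominated by \<open>w\<close>: the cop chases the image of the robber under the
  retraction sending \<open>v\<close> to \<open>w\<close>, and having caught it, catches the robber one move later.\<close>
lemma cop_wins_lift_retract:
  assumes "cops_win_from (\<lambda>x y. E x y \<and> x \<in> U \<and> y \<in> U) t [c] s"
    and "c \<in> U" "w \<in> U" "v \<notin> U" "s = (if x = v then w else x)"
    and "x \<in> insert v U"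
    and sym: "\<And>x y. E x y \<Longrightarrow> E y x"
    and dom: "\<And>q. q \<in> insert v U \<Longrightarrow> q = v \<or> E v q \<Longrightarrow> q = w \<or> E w q"
  shows "cops_win_from (\<lambda>x y. E x y \<and> x \<in> insert v U \<and> y \<in> insert v U) t [c] x"
    (is "cops_win_from ?F t [c] x")
  using assms(1-6)
proof (induction t "[c]" s arbitrary: c x)
  case (caught s t)
  have sweep: "cops_win_from ?F True [w] q" if "q \<in> insert v U" "q = v \<or> E v q" for q
    by (rule cops_win_from.cops_move[where cs' = "[q]"])
      (use dom[OF that] that \<open>w \<in> U\<close> in \<open>auto intro: cops_win_from.caught\<close>)
  show ?case
  proof (cases "x = c")
    case True
    then show ?thesis by (auto intro: cops_win_from.caught)
  next
    case False
    \<comment> \<open>The image is caught but the robber is not, so the robber is on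
      \<open>v\<close> and the cop on \<open>w\<close>. As \<open>w\<close> dominates
      \<open>v\<close>, the cop's next move captures, even if the robber moves first.\<close>
    then have x: "x = v" "c = w" using caught by (auto split: if_splits)
    show ?thesis
    proof (cases t)
      case True
      then show ?thesis using sweep[of v] x by auto
    next
      case False
      then have t: "t = False" by simp
      show ?thesis unfolding x t
        by (rule cops_win_from.robber_move) (use sweep in auto)
    qed
  qed
next
  case (cops_move cs' s)
  obtain c' where c': "cs' = [c']" "c' = c \<or> E c c' \<and> c \<in> U \<and> c' \<in> U"
    using cops_move(1) by (auto simp: list_all2_Cons1)
  have "cops_win_from ?F False [c'] x"
    using cops_move c' by blast
  then show ?case
    by (rule cops_win_from.cops_move[rotated]) (use c' in auto)
next
  case (robber_move s c)
  show ?case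
  proof (rule cops_win_from.robber_move)
    fix x' assume x': "x' = x \<or> ?F x x'"
    then have xx: "x' \<in> insert v U" using robber_move by auto
    define s' where "s' = (if x' = v then w else x')"
    \<comment> \<open>The image of a robber move is legal inside \<open>U\<close>: leaving
      \<open>v\<close> becomes leaving \<open>w\<close> by \<open>dom\<close>, and entering
      \<open>v\<close> becomes entering \<open>w\<close> by \<open>dom\<close> and symmetry.\<close>
    have "s' = s \<or> E s s' \<and> s \<in> U \<and> s' \<in> U"
      using x' robber_move(4-7) xx dom[of x'] dom[of x] sym unfolding s'_def
      by (auto split: if_splits)
    then show "cops_win_from ?F True [c] x'"
      using robber_move(2)[of s' x'] robber_move(3-7) xx s'_def by auto
  qed
qed

text \<open>Vertices are removed by decreasing \<open>f\<close>, and
  \<open>cop_wins_lift_retract\<close> adds them back one at a time. Domination is asked against all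
  \<open>q\<close> with \<open>f q \<le> f v\<close>, so ties may be removed in any order; the
  strict \<open>f w < f v\<close> ensures that \<open>w\<close> is still present when
  \<open>v\<close> goes. The clique alternative ends the induction.\<close>

lemma k_cops_win_dismantlable:
  fixes f :: "'a \<Rightarrow> 'b :: linorder"
  assumes "finite U" "U \<noteq> {}"
    and sym: "\<And>x y. E x y \<Longrightarrow> E y x"
    and dom: "\<And>v. v \<in> U \<Longrightarrow>
      (\<forall>x\<in>U. \<forall>y\<in>U. f x \<le> f v \<longrightarrow> f y \<le> f v \<longrightarrow> x = y \<or> E x y) \<or>
      (\<exists>w\<in>U. f w < f v \<and> (\<forall>q\<in>U. f q \<le> f v \<longrightarrow> q = v \<or> E v q \<longrightarrow> q = w \<or> E w q))"
  shows "k_cops_win U (\<lambda>x y. E x y \<and> x \<in> U \<and> y \<in> U) 1"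
proof -
  \<comment> \<open>\<open>W\<close> ranges over the sets met during removal. They are closed only
    under strictly smaller \<open>f\<close>, since vertices tied with a remaining one may already be
    gone.\<close>
  have "\<exists>c\<in>W. \<forall>x\<in>W. cops_win_from (\<lambda>x y. E x y \<and> x \<in> W \<and> y \<in> W) True [c] x"
    if "finite W" "W \<noteq> {}" "W \<subseteq> U" "\<And>x y. x \<in> W \<Longrightarrow> y \<in> U \<Longrightarrow> f y < f x \<Longrightarrow> y \<in> W" for W
    using that
  proof (induction W rule: finite_psubset_induct)
    case (psubset W)
    have "Max (f ` W) \<in> f ` W" using psubset by (intro Max_in) auto
    then obtain v where v: "v \<in> W" "f v = Max (f ` W)" by auto
    have max: "f x \<le> f v" if "x \<in> W" for x
      unfolding v(2) using that psubset.hyps by (intro Max_ge) auto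
    show ?case
    proof (cases "\<forall>x\<in>U. \<forall>y\<in>U. f x \<le> f v \<longrightarrow> f y \<le> f v \<longrightarrow> x = y \<or> E x y")
      case True
      then have "cops_win_from (\<lambda>x y. E x y \<and> x \<in> W \<and> y \<in> W) True [v] x" if "x \<in> W" for x
        by (intro cops_win_from.cops_move[where cs' = "[x]"])
          (use that v max psubset.prems(2) in \<open>auto intro: cops_win_from.caught\<close>)
      then show ?thesis using v by blast
    next
      case False
      then obtain w where w: "w \<in> U" "f w < f v"
        "\<And>q. q \<in> U \<Longrightarrow> f q \<le> f v \<Longrightarrow> q = v \<or> E v q \<Longrightarrow> q = w \<or> E w q"
        using dom[of v] v psubset.prems(2) by blast
      define W' where "W' = W - {v}"
      have "w \<in> W" using psubset.prems(3) v w by blast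
      then have W: "W = insert v W'" "v \<notin> W'" "w \<in> W'" "W' \<subset> W" "W' \<noteq> {}" "W' \<subseteq> U"
        using v w psubset.prems(2) by (auto simp: W'_def)
      have "\<exists>c\<in>W'. \<forall>x\<in>W'. cops_win_from (\<lambda>x y. E x y \<and> x \<in> W' \<and> y \<in> W') True [c] x"
      proof (rule psubset.IH[OF W(4,5,6)])
        show "y \<in> W'" if "x \<in> W'" "y \<in> U" "f y < f x" for x y
          using that psubset.prems(3)[of x y] max[of x] by (auto simp: W'_def)
      qed
      then obtain c where c: "c \<in> W'"
        "\<And>x. x \<in> W' \<Longrightarrow> cops_win_from (\<lambda>x y. E x y \<and> x \<in> W' \<and> y \<in> W') True [c] x"
        by blast
      have wq: "q = w \<or> E w q" if "q \<in> insert v W'" "q = v \<or> E v q" for q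
        using w(3)[of q] that W max psubset.prems(2) by blast
      have "cops_win_from (\<lambda>x y. E x y \<and> x \<in> W \<and> y \<in> W) True [c] x" if "x \<in> W" for x
        unfolding W(1)
        by (rule cop_wins_lift_retract[OF c(2)[of "if x = v then w else x"], where w = w])
          (use that W(1-3) c(1) wq sym in auto)
      then show ?thesis using c W by blast
    qed
  qed
  from this[OF assms(1,2)] obtain c where
    "c \<in> U" "\<forall>x\<in>U. cops_win_from (\<lambda>x y. E x y \<and> x \<in> U \<and> y \<in> U) True [c] x"
    by blast
  then show ?thesis unfolding k_cops_win_def by (intro exI[of _ "[c]"]) auto
qed

lemma cop_number_eq_1: "k_cops_win V E 1 \<Longrightarrow> cop_number V E = 1"
  unfolding cop_number_def by (rule Least_equality) auto

subsection \<open>Domination within a disc\<close>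

text \<open>\<open>cross2 x e\<close> is the inner product of \<open>x\<close> with the quarter turn
  \<open>(- e $ 2, e $ 1)\<close> of \<open>e\<close>. With \<open>x \<bullet> e\<close> it gives
  the coordinates of \<open>x\<close> across and along \<open>e\<close>, both scaled by
  \<open>norm e\<close>.\<close>

definition cross2 :: "real^2 \<Rightarrow> real^2 \<Rightarrow> real" where
  "cross2 x y = x$2 * y$1 - x$1 * y$2"

lemma inner_real2: "x \<bullet> y = x$1 * y$1 + x$2 * y$2" for x y :: "real^2"
  by (simp add: inner_vec_def sum_2)

text \<open>This is the inner product in the orthogonal frame of \<open>e\<close> and its quarter
  turn. Keeping the factor on the left avoids divisions in the estimates below.\<close>

lemma inner_mult_norm_cross2:
  "(norm e)\<^sup>2 * (a \<bullet> u) = (u \<bullet> e) * (a \<bullet> e) + cross2 u e * cross2 a e" for e :: "real^2"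
  unfolding power2_norm_eq_inner inner_real2 cross2_def by algebra

lemma norm_mult_norm_cross2:
  "(norm e)\<^sup>2 * (norm u)\<^sup>2 = (u \<bullet> e)\<^sup>2 + (cross2 u e)\<^sup>2" for e :: "real^2"
  using inner_mult_norm_cross2[of e u u] by (simp flip: power2_norm_eq_inner add: power2_eq_square)

lemma abs_cross2_le: "\<bar>cross2 a e\<bar> \<le> norm a * norm e"
  by (rule power2_le_imp_le)
    (use norm_mult_norm_cross2[of e a] in \<open>auto simp: power_mult_distrib mult.commute\<close>)

text \<open>With \<open>e\<close> pointing from a vertex to the centre of the square, these are the displacements
  \<open>u\<close> to a dominating vertex. They form a rectangle with sides parallel and orthogonal to \<open>e\<close>;
  for \<open>norm e\<close> of order 1 its side lengths are of order \<open>r\<^sup>2\<close> and \<open>r\<^sup>3\<close>.\<close>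
definition inward_step :: "real \<Rightarrow> real^2 \<Rightarrow> real^2 \<Rightarrow> bool" where
  "inward_step r e u \<longleftrightarrow> r\<^sup>2 / 10 \<le> u \<bullet> e \<and> u \<bullet> e \<le> r\<^sup>2 / 5 \<and> \<bar>cross2 u e\<bar> \<le> r ^ 3 / 40"

lemma inward_step_cross2_sq:
  assumes "inward_step r e u" "0 < r"
  shows "(cross2 u e)\<^sup>2 \<le> r ^ 6 / 1600"
proof -
  have "(cross2 u e)\<^sup>2 \<le> (r ^ 3 / 40)\<^sup>2"
    using assms power_mono[of "\<bar>cross2 u e\<bar>" "r ^ 3 / 40" 2] by (simp add: inward_step_def)
  then show ?thesis by (simp add: power_divide)
qed

text \<open>The vertex is the origin, the centre is \<open>e\<close>, and \<open>a\<close> is any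
  point of the lens. Lying in the disc around \<open>e\<close> gives
  \<open>(norm a)\<^sup>2 \<le> 2 * (a \<bullet> e)\<close>. So, after multiplying by
  \<open>(norm e)\<^sup>2\<close>, the inward component of \<open>u\<close> gains
  \<open>(u \<bullet> e) * (norm a)\<^sup>2\<close>, which has to pay for the sideways component and
  for \<open>norm u\<close>.\<close>

lemma inward_step_covers_lens:
  assumes st: "inward_step r e u" and r: "0 < r" "r \<le> 2 * norm e" and e: "norm e \<le> 1"
    and a: "norm a \<le> r" "norm (a - e) \<le> norm e"
  shows "norm (a - u) \<le> r"
proof (rule power2_le_imp_le)
  let ?\<rho> = "norm e" and ?\<alpha> = "u \<bullet> e" and ?\<beta> = "cross2 u e"
  have \<rho>: "0 < ?\<rho>" using r by linarith
  have b: "r\<^sup>2 / 10 \<le> ?\<alpha>" "?\<alpha> \<le> r\<^sup>2 / 5" "\<bar>?\<beta>\<bar> \<le> r ^ 3 / 40"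
    using st by (auto simp: inward_step_def)
  have r2: "r\<^sup>2 \<le> 4 * ?\<rho>\<^sup>2"
    using power_mono[of r "2 * ?\<rho>" 2] r by (simp add: power_mult_distrib)
  have "(norm (a - e))\<^sup>2 \<le> ?\<rho>\<^sup>2" using a by (intro power_mono) auto
  then have ae: "(norm a)\<^sup>2 \<le> 2 * (a \<bullet> e)"
    by (simp add: power2_norm_eq_inner inner_diff inner_commute)
  have \<alpha>0: "0 \<le> ?\<alpha>" using b(1) by (meson order_trans zero_le_divide_iff zero_le_power2 zero_le_numeral)
  have "?\<beta> * cross2 a e \<ge> - (\<bar>?\<beta>\<bar> * \<bar>cross2 a e\<bar>)"
    by (metis abs_ge_minus_self abs_mult minus_le_iff)
  moreover have "\<bar>?\<beta>\<bar> * \<bar>cross2 a e\<bar> \<le> r ^ 3 / 40 * (r * 1)"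
  proof (rule mult_mono)
    show "\<bar>cross2 a e\<bar> \<le> r * 1"
      using abs_cross2_le[of a e] mult_mono[of "norm a" r ?\<rho> 1] a e r by simp
  qed (use b r in auto)
  ultimately have "?\<beta> * cross2 a e \<ge> - (r ^ 4 / 40)"
    by (simp add: eval_nat_numeral)
  moreover have "?\<alpha> * (2 * (a \<bullet> e)) \<ge> ?\<alpha> * (norm a)\<^sup>2"
    using ae \<alpha>0 by (rule mult_left_mono)
  ultimately have "2 * (?\<rho>\<^sup>2 * (a \<bullet> u)) \<ge> ?\<alpha> * (norm a)\<^sup>2 - r ^ 4 / 20"
    unfolding inner_mult_norm_cross2 by simp
  moreover have "?\<rho>\<^sup>2 * (norm (a - u))\<^sup>2 =
      ?\<rho>\<^sup>2 * (norm a)\<^sup>2 - 2 * (?\<rho>\<^sup>2 * (a \<bullet> u)) + ?\<rho>\<^sup>2 * (norm u)\<^sup>2"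
    by (simp add: power2_norm_eq_inner inner_diff inner_commute algebra_simps)
  ultimately have "?\<rho>\<^sup>2 * (norm (a - u))\<^sup>2 \<le>
      (?\<rho>\<^sup>2 - ?\<alpha>) * (norm a)\<^sup>2 + r ^ 4 / 20 + ?\<alpha>\<^sup>2 + ?\<beta>\<^sup>2"
    using norm_mult_norm_cross2[of e u] left_diff_distrib[of "?\<rho>\<^sup>2" ?\<alpha> "(norm a)\<^sup>2"] by linarith
  \<comment> \<open>The coefficient of \<open>(norm a)\<^sup>2\<close> is nonnegative, so
    \<open>norm a = r\<close> is the worst case.\<close>
  also have "\<dots> \<le> (?\<rho>\<^sup>2 - ?\<alpha>) * r\<^sup>2 + r ^ 4 / 20 + ?\<alpha> * (r\<^sup>2 / 5) + r ^ 6 / 1600"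
  proof (intro add_mono order_refl mult_left_mono)
    show "(norm a)\<^sup>2 \<le> r\<^sup>2" using a by (intro power_mono) auto
    show "0 \<le> ?\<rho>\<^sup>2 - ?\<alpha>" using b(2) r2 zero_le_power2[of ?\<rho>] by linarith
    show "?\<alpha>\<^sup>2 \<le> ?\<alpha> * (r\<^sup>2 / 5)"
      unfolding power2_eq_square[of ?\<alpha>] by (rule mult_left_mono[OF b(2) \<alpha>0])
    show "?\<beta>\<^sup>2 \<le> r ^ 6 / 1600" using st r(1) by (rule inward_step_cross2_sq)
  qed
  \<comment> \<open>The constants balance here: \<open>?\<alpha> * r\<^sup>2\<close> less a fifth of
    it is at least \<open>0.08 * r ^ 4\<close>, while the losses are \<open>r ^ 4 / 20\<close> and
    \<open>r ^ 6 / 1600 \<le> r ^ 4 / 400\<close>.\<close>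
  also have "\<dots> \<le> ?\<rho>\<^sup>2 * r\<^sup>2"
  proof -
    have "r\<^sup>2 \<le> 4" using r2 power_mono[of ?\<rho> 1 2] e by simp
    then have "r ^ 6 \<le> 4 * r ^ 4"
      using mult_right_mono[of "r\<^sup>2" 4 "r ^ 4"] by (simp flip: power_add)
    moreover have "r ^ 4 / 10 \<le> ?\<alpha> * r\<^sup>2"
      using mult_right_mono[OF b(1), of "r\<^sup>2"] by (simp flip: power_add)
    moreover have "0 \<le> r ^ 4" by simp
    ultimately show ?thesis
      using left_diff_distrib[of "?\<rho>\<^sup>2" ?\<alpha> "r\<^sup>2"] by linarith
  qed
  finally show "(norm (a - u))\<^sup>2 \<le> r\<^sup>2" using \<rho> by simp
qed (use r in simp)

text \<open>Multiplied by \<open>(norm e)\<^sup>2\<close>, the squared distance to the centre drops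
  by at least \<open>(u \<bullet> e) * (norm e)\<^sup>2 \<ge> r ^ 4 / 40\<close> through the inward
  component; the sideways one adds back at most
  \<open>r ^ 6 / 1600 \<le> r ^ 4 / 400\<close>.\<close>

lemma inward_step_closer:
  assumes st: "inward_step r e u" and r: "0 < r" "r \<le> 2 * norm e" and e: "norm e \<le> 1"
  shows "norm (u - e) < norm e"
proof (rule power2_less_imp_less)
  let ?\<rho> = "norm e" and ?\<alpha> = "u \<bullet> e" and ?\<beta> = "cross2 u e"
  have \<rho>: "0 < ?\<rho>" using r by linarith
  have b: "r\<^sup>2 / 10 \<le> ?\<alpha>" "?\<alpha> \<le> r\<^sup>2 / 5"
    using st by (auto simp: inward_step_def)
  have r2: "r\<^sup>2 \<le> 4 * ?\<rho>\<^sup>2"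
    using power_mono[of r "2 * ?\<rho>" 2] r by (simp add: power_mult_distrib)
  have r4: "r\<^sup>2 \<le> 4" using r2 power_mono[of ?\<rho> 1 2] e by simp
  have \<alpha>0: "0 < ?\<alpha>" using b(1) r by (smt (verit) divide_pos_pos zero_less_power)
  have "?\<alpha> * ?\<alpha> \<le> ?\<alpha> * ?\<rho>\<^sup>2"
    using b(2) r2 \<alpha>0 by (intro mult_left_mono) auto
  moreover have "?\<beta>\<^sup>2 < ?\<alpha> * ?\<rho>\<^sup>2"
  proof -
    have "?\<beta>\<^sup>2 \<le> r ^ 6 / 1600" using st r(1) by (rule inward_step_cross2_sq)
    also have "\<dots> = r\<^sup>2 * r\<^sup>2 * r\<^sup>2 / 1600" by (simp flip: power_add)
    also have "\<dots> \<le> 4 * r\<^sup>2 * (4 * ?\<rho>\<^sup>2) / 1600"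
      using r4 r2 by (intro divide_right_mono mult_mono) auto
    also have "\<dots> < r\<^sup>2 / 10 * ?\<rho>\<^sup>2" using \<rho> r by simp
    also have "\<dots> \<le> ?\<alpha> * ?\<rho>\<^sup>2" using b(1) by (intro mult_right_mono) auto
    finally show ?thesis .
  qed
  moreover have "?\<rho>\<^sup>2 * (norm (u - e))\<^sup>2 = ?\<rho>\<^sup>2 * (norm u)\<^sup>2 - 2 * (?\<alpha> * ?\<rho>\<^sup>2) + ?\<rho>\<^sup>2 * ?\<rho>\<^sup>2"
    by (simp add: power2_norm_eq_inner inner_diff inner_commute algebra_simps)
  ultimately have "?\<rho>\<^sup>2 * (norm (u - e))\<^sup>2 < ?\<rho>\<^sup>2 * ?\<rho>\<^sup>2"
    using norm_mult_norm_cross2[of e u] power2_eq_square[of ?\<alpha>] by linarith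
  then show "(norm (u - e))\<^sup>2 < ?\<rho>\<^sup>2"
    using \<rho> by (meson mult_less_cancel_left_pos zero_less_power)
qed simp

text \<open>Ensures that the boundary of the square cuts nothing off the rectangle. The inward
  component shrinks both coordinates relative to the centre, and the sideways one, at most half as
  large, cannot use up the room gained.\<close>

lemma inward_step_stays_in_square:
  assumes st: "inward_step r e u" and r: "0 < r" "r \<le> 2 * norm e" and e: "norm e \<le> 1"
    and sq: "\<And>i. \<bar>e $ i\<bar> \<le> 1 / 2"
  shows "\<bar>(u - e) $ i\<bar> \<le> 1 / 2"
proof -
  let ?\<rho> = "norm e" and ?\<alpha> = "u \<bullet> e" and ?\<beta> = "cross2 u e"
  have \<rho>: "0 < ?\<rho>" using r by linarith
  have b: "r\<^sup>2 / 10 \<le> ?\<alpha>" "?\<alpha> \<le> r\<^sup>2 / 5" "\<bar>?\<beta>\<bar> \<le> r ^ 3 / 40"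
    using st by (auto simp: inward_step_def)
  have r2: "r\<^sup>2 \<le> 4 * ?\<rho>\<^sup>2"
    using power_mono[of r "2 * ?\<rho>" 2] r by (simp add: power_mult_distrib)
  have "r ^ 3 \<le> r\<^sup>2 * 2"
    using mult_left_mono[of r 2 "r\<^sup>2"] r e by (simp add: eval_nat_numeral)
  have le: "?\<alpha> \<le> ?\<rho>\<^sup>2" using b(2) r2 zero_le_power2[of ?\<rho>] by linarith
  from \<open>r ^ 3 \<le> r\<^sup>2 * 2\<close> have \<beta>\<alpha>: "\<bar>?\<beta>\<bar> \<le> ?\<alpha> / 2" using b by linarith
  have "?\<rho>\<^sup>2 * u $ i = ?\<alpha> * e $ i + ?\<beta> * (if i = 1 then - e $ 2 else e $ 1)"
    using exhaust_2[of i] unfolding power2_norm_eq_inner inner_real2 cross2_def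
    by (elim disjE) (simp_all add: algebra_simps)
  then have eq: "?\<rho>\<^sup>2 * (u - e) $ i =
      - (?\<rho>\<^sup>2 - ?\<alpha>) * e $ i + ?\<beta> * (if i = 1 then - e $ 2 else e $ 1)"
    by (simp add: algebra_simps)
  have "?\<rho>\<^sup>2 * \<bar>(u - e) $ i\<bar> = \<bar>?\<rho>\<^sup>2 * (u - e) $ i\<bar>" by (simp add: abs_mult)
  also have "\<dots> \<le> \<bar>(?\<rho>\<^sup>2 - ?\<alpha>) * e $ i\<bar> + \<bar>?\<beta> * (if i = 1 then - e $ 2 else e $ 1)\<bar>"
    unfolding eq by (rule order_trans[OF abs_triangle_ineq]) (simp add: abs_mult abs_minus_commute)
  also have "\<dots> = (?\<rho>\<^sup>2 - ?\<alpha>) * \<bar>e $ i\<bar> + \<bar>?\<beta>\<bar> * \<bar>if i = 1 then - e $ 2 else e $ 1\<bar>"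
    using le by (simp add: abs_mult)
  also have "\<dots> \<le> (?\<rho>\<^sup>2 - ?\<alpha>) * (1 / 2) + (?\<alpha> / 2) * (1 / 2)"
    using le \<beta>\<alpha> sq by (intro add_mono mult_mono) (auto intro: order_trans)
  also have "\<dots> \<le> ?\<rho>\<^sup>2 * (1 / 2)" using \<beta>\<alpha> by (simp add: algebra_simps)
  finally show ?thesis using \<rho> by simp
qed

text \<open>Taking \<open>u\<close> to \<open>(u \<bullet> e, cross2 u e)\<close> is a similarity of
  ratio \<open>norm e\<close>, and the set is the preimage of a box with sides
  \<open>r\<^sup>2 / 10\<close> and \<open>r ^ 3 / 20\<close>.\<close>

lemma measure_inward_step:
  assumes "0 < r" "e \<noteq> 0"
  shows "measure lborel {u. inward_step r e u} = r ^ 5 / (200 * (norm e)\<^sup>2)"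
proof -
  define N where "N = (norm e)\<^sup>2"
  have N: "N = e$1 * e$1 + e$2 * e$2" "N > 0"
    unfolding N_def using assms by (simp add: power2_norm_eq_inner inner_real2, simp)
  \<comment> \<open>The inverse of this similarity, so that the set becomes a linear image of the
    box \<open>B\<close>.\<close>
  define f :: "real^2 \<Rightarrow> real^2" where
    "f = (\<lambda>x. vector [(x$1 * e$1 - x$2 * e$2) / N, (x$1 * e$2 + x$2 * e$1) / N])"
  define B :: "(real^2) set" where
    "B = cbox (vector [r\<^sup>2 / 10, - (r ^ 3 / 40)]) (vector [r\<^sup>2 / 5, r ^ 3 / 40])"
  have lin: "linear f"
    by (rule linearI) (simp_all add: f_def vec_eq_iff forall_2 add_divide_distrib diff_divide_distrib algebra_simps)
  have det: "det (matrix f) = 1 / N"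
  proof -
    have "det (matrix f) = (e$1 * e$1 + e$2 * e$2) / (N * N)"
      by (simp add: det_2 matrix_def f_def axis_def add_divide_distrib)
    then show ?thesis unfolding N(1)[symmetric] using N(2) by simp
  qed
  have memB: "x \<in> B \<longleftrightarrow> r\<^sup>2 / 10 \<le> x$1 \<and> x$1 \<le> r\<^sup>2 / 5 \<and> \<bar>x$2\<bar> \<le> r ^ 3 / 40" for x
    by (auto simp: B_def mem_box_cart forall_2)
  have im: "{u. inward_step r e u} = f ` B"
  proof (intro equalityI subsetI)
    fix u assume u: "u \<in> {u. inward_step r e u}"
    let ?x = "vector [u \<bullet> e, cross2 u e] :: real^2"
    have "(u$1 * e$1 + u$2 * e$2) * e$1 - (u$2 * e$1 - u$1 * e$2) * e$2 = u$1 * N"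
      "(u$1 * e$1 + u$2 * e$2) * e$2 + (u$2 * e$1 - u$1 * e$2) * e$1 = u$2 * N"
      unfolding N by algebra+
    then have "f ?x = u"
      using N(2) by (simp add: f_def vec_eq_iff forall_2 inner_real2 cross2_def)
    moreover have "?x \<in> B" using u by (simp add: memB inward_step_def)
    ultimately show "u \<in> f ` B" by (metis imageI)
  next
    fix u assume "u \<in> f ` B"
    then obtain x where x: "x \<in> B" "u = f x" by auto
    have "(x$1 * e$1 - x$2 * e$2) * e$1 + (x$1 * e$2 + x$2 * e$1) * e$2 = x$1 * N"
      "(x$1 * e$2 + x$2 * e$1) * e$1 - (x$1 * e$1 - x$2 * e$2) * e$2 = x$2 * N"
      unfolding N by algebra+
    then have "f x \<bullet> e = x$1" "cross2 (f x) e = x$2"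
      using N(2) by (simp_all add: f_def inner_real2 cross2_def flip: add_divide_distrib diff_divide_distrib)
    then show "u \<in> {u. inward_step r e u}" using x by (simp add: inward_step_def memB)
  qed
  have Bm: "B \<in> lmeasurable" by (simp add: B_def)
  have "measure lebesgue B = (r\<^sup>2 / 10) * (r ^ 3 / 20)"
  proof -
    \<comment> \<open>Any first coordinate between \<open>r\<^sup>2 / 10\<close> and
      \<open>r\<^sup>2 / 5\<close> would do; the volume formula needs a nonempty box.\<close>
    have "vector [r\<^sup>2 / 7, 0] \<in> B" using assms by (simp add: memB)
    then have "B \<noteq> {}" by blast
    then show ?thesis unfolding B_def by (simp add: content_cbox_cart UNIV_2)
  qed
  then have "measure lebesgue B = r ^ 5 / 200" by (simp flip: power_add)
  then have "measure lebesgue (f ` B) = r ^ 5 / (200 * N)"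
    using measure_linear_image[OF lin, of B] det N(2) by (simp add: Bm field_simps)
  moreover have "f ` B \<in> sets borel"
    unfolding B_def by (intro borel_compact compact_continuous_image linear_continuous_on
      linear_conv_bounded_linear[THEN iffD1] lin compact_cbox)
  ultimately show ?thesis
    by (simp add: im N_def measure_completion)
qed

subsection \<open>Independent points\<close>

text \<open>Once coordinate \<open>i\<close> is fixed, the other \<open>card I - 1\<close>
  coordinates are independent, and each is unrelated to it with probability at most
  \<open>1 - q \<le> exp (- q)\<close>.\<close>

lemma (in prob_space) emeasure_PiM_no_related_coordinate_le:
  assumes fin: "finite I" and i: "i \<in> I"
    and P[measurable]: "Measurable.pred M P"
    and D[measurable]: "Measurable.pred (M \<Otimes>\<^sub>M M) (\<lambda>z. D (fst z) (snd z))"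
    and q: "\<And>x. x \<in> space M \<Longrightarrow> P x \<Longrightarrow> q \<le> prob {y \<in> space M. D x y}"
  shows "emeasure (PiM I (\<lambda>_. M))
      {p \<in> space (PiM I (\<lambda>_. M)). P (p i) \<and> (\<forall>j\<in>I - {i}. \<not> D (p i) (p j))}
    \<le> ennreal (exp (- (q * real (card I - 1))))"
proof -
  define J where "J = I - {i}"
  have J: "finite J" "i \<notin> J" "insert i J = I" "card J = card I - 1"
    using fin i by (auto simp: J_def)
  interpret PJ: product_prob_space "\<lambda>_. M" J by unfold_locales
  interpret PI: product_prob_space "\<lambda>_. M" I by unfold_locales
  let ?E = "{p \<in> space (PiM I (\<lambda>_. M)). P (p i) \<and> (\<forall>j\<in>J. \<not> D (p i) (p j))}"
  have Dm: "Measurable.pred (PiM I (\<lambda>_. M)) (\<lambda>p. D (p i) (p j))" if "j \<in> J" for j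
    using measurable_compose[OF _ D, of "\<lambda>p. (p i, p j)" "PiM I (\<lambda>_. M)"] that i J
    by auto
  have E: "?E \<in> sets (PiM I (\<lambda>_. M))"
    using Dm J(1) i by measurable
  have bound: "(\<integral>\<^sup>+ x. indicator ?E (x(i := y)) \<partial>PiM J (\<lambda>_. M)) \<le> ennreal (exp (- (q * real (card J))))"
    if y: "y \<in> space M" for y
  proof (cases "P y")
    case True
    let ?A = "{z \<in> space M. \<not> D y z}"
    have Dy: "{z \<in> space M. D y z} \<in> sets M"
      using measurable_compose[OF measurable_Pair1'[OF y] D] by (simp add: pred_def)
    have A: "?A = space M - {z \<in> space M. D y z}" by auto
    \<comment> \<open>With \<open>y\<close> fixed, the event is a product set in the remaining
      coordinates.\<close>
    have "(\<integral>\<^sup>+ x. indicator ?E (x(i := y)) \<partial>PiM J (\<lambda>_. M)) =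
        (\<integral>\<^sup>+ x. indicator (PiE J (\<lambda>_. ?A)) x \<partial>PiM J (\<lambda>_. M))"
      using y True J
      by (intro nn_integral_cong)
        (auto simp: space_PiM indicator_def PiE_iff extensional_def split: if_splits)
    also have "\<dots> = (\<Prod>j\<in>J. emeasure M ?A)"
      unfolding A using J Dy by (subst nn_integral_indicator) (auto intro!: sets_PiM_I_finite simp: PJ.emeasure_PiM)
    also have "\<dots> = ennreal (prob ?A ^ card J)"
      by (simp add: emeasure_eq_measure ennreal_power)
    also have "\<dots> \<le> ennreal (exp (- (q * real (card J))))"
    proof (rule ennreal_leI)
      have "prob ?A \<le> exp (- prob {z \<in> space M. D y z})"
        unfolding A prob_compl[OF Dy] using exp_ge_add_one_self[of "- prob {z \<in> space M. D y z}"] by simp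
      also have "\<dots> \<le> exp (- q)" using q[OF y True] by simp
      finally have "prob ?A ^ card J \<le> exp (- q) ^ card J" by (intro power_mono) auto
      then show "prob ?A ^ card J \<le> exp (- (q * real (card J)))"
        by (simp add: mult.commute flip: exp_of_nat_mult)
    qed
    finally show ?thesis .
  next
    case False
    then show ?thesis by simp
  qed
  have "emeasure (PiM I (\<lambda>_. M)) ?E = (\<integral>\<^sup>+ x. indicator ?E x \<partial>PiM (insert i J) (\<lambda>_. M))"
    using E J by simp
  \<comment> \<open>Tonelli with coordinate \<open>i\<close> outermost, so that the inner integral
    sees it as a constant.\<close>
  also have "\<dots> = (\<integral>\<^sup>+ y. \<integral>\<^sup>+ x. indicator ?E (x(i := y)) \<partial>PiM J (\<lambda>_. M) \<partial>M)"
    using J E by (intro PJ.product_nn_integral_insert_rev) auto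
  also have "\<dots> \<le> (\<integral>\<^sup>+ y. ennreal (exp (- (q * real (card J)))) \<partial>M)"
    by (intro nn_integral_mono bound) auto
  also have "\<dots> = ennreal (exp (- (q * real (card I - 1))))"
    by (simp add: emeasure_space_1 J(4))
  finally show ?thesis by (simp add: J_def)
qed

subsection \<open>Points in the unit square\<close>

definition square_centre :: "real^2" where "square_centre = vec (1 / 2)"

lemma unit_square_eq_cbox: "unit_square = cbox 0 1"
  by (auto simp: unit_square_def mem_box_cart)

lemma sets_unit_square[measurable, simp]: "unit_square \<in> sets borel"
  by (simp add: unit_square_eq_cbox)

lemma emeasure_unit_square: "emeasure lborel unit_square = 1"
proof -
  have "(0 :: real^2) \<in> cbox 0 1" by (simp add: mem_box_cart)
  then have "measure lborel (cbox 0 1 :: (real^2) set) = 1"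
    by (subst content_cbox_cart) auto
  then show ?thesis
    unfolding unit_square_eq_cbox 
    by (subst emeasure_eq_ennreal_measure)
      (use emeasure_lborel_cbox_finite[of 0 "1 :: real^2"] in auto)
qed

lemma prob_space_uniform_square: "prob_space (uniform_measure lborel unit_square)"
  by (rule prob_space_uniform_measure) (simp_all add: emeasure_unit_square)

lemma mem_unit_square_iff: "x \<in> unit_square \<longleftrightarrow> (\<forall>i. \<bar>(square_centre - x) $ i\<bar> \<le> 1 / 2)"
  unfolding unit_square_def square_centre_def by (auto simp: abs_le_iff) (smt (verit, best) field_sum_of_halves)+

lemma norm_square_centre_diff_le:
  assumes "x \<in> unit_square"
  shows "norm (square_centre - x) \<le> 1"
proof -
  have "norm (square_centre - x) \<le> (\<Sum>i\<in>UNIV. \<bar>(square_centre - x) $ i\<bar>)" by (rule norm_le_l1_cart)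
  also have "\<dots> \<le> (\<Sum>i\<in>(UNIV :: 2 set). 1 / 2)"
    using assms unfolding mem_unit_square_iff by (intro sum_mono) auto
  finally show ?thesis by simp
qed

text \<open>The deterministic part: the dismantling order is by distance to the centre, and it
  remains to bound the probability that \<open>step\<close> fails.\<close>

lemma cop_number_rgg_eq_1:
  assumes n: "n > 0" and r: "r > 0"
    and sq: "\<And>i. i < n \<Longrightarrow> p i \<in> unit_square"
    and step: "\<And>i. i < n \<Longrightarrow> r < 2 * norm (square_centre - p i) \<Longrightarrow>
      \<exists>j<n. inward_step r (square_centre - p i) (p j - p i)"
  shows "cop_number {..<n} (rgg_adj n r p) = 1"
proof (rule cop_number_eq_1)
  have "k_cops_win {..<n} (\<lambda>x y. rgg_adj n r p x y \<and> x \<in> {..<n} \<and> y \<in> {..<n}) 1"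
  proof (rule k_cops_win_dismantlable[where f = "\<lambda>i. norm (square_centre - p i)"])
    fix v assume v: "v \<in> {..<n}"
    let ?e = "square_centre - p v"
    show "(\<forall>x\<in>{..<n}. \<forall>y\<in>{..<n}. norm (square_centre - p x) \<le> norm ?e \<longrightarrow> norm (square_centre - p y) \<le> norm ?e \<longrightarrow>
        x = y \<or> rgg_adj n r p x y) \<or>
      (\<exists>w\<in>{..<n}. norm (square_centre - p w) < norm ?e \<and> (\<forall>q\<in>{..<n}. norm (square_centre - p q) \<le> norm ?e \<longrightarrow>
        q = v \<or> rgg_adj n r p v q \<longrightarrow> q = w \<or> rgg_adj n r p w q))"
    proof (cases "r < 2 * norm ?e")
      case False
      \<comment> \<open>Two points within \<open>norm ?e\<close> of the centre are at most
        \<open>2 * norm ?e \<le> r\<close> apart.\<close>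
      have "dist (p x) (p y) \<le> r" if "norm (square_centre - p x) \<le> norm ?e" "norm (square_centre - p y) \<le> norm ?e" for x y
        using norm_triangle_ineq4[of "square_centre - p y" "square_centre - p x"] that False by (simp add: dist_norm)
      then show ?thesis by (auto simp: rgg_adj_def)
    next
      case True
      obtain w where w: "w < n" "inward_step r ?e (p w - p v)" using step v True by blast
      have e1: "norm ?e \<le> 1" using norm_square_centre_diff_le sq v by simp
      have "norm (square_centre - p w) < norm ?e"
        using inward_step_closer[OF w(2) r _ e1] True by (simp add: norm_minus_commute)
      moreover have "dist (p w) (p q) \<le> r"
        if "norm (square_centre - p q) \<le> norm ?e" "q = v \<or> rgg_adj n r p v q" for q
        using inward_step_covers_lens[OF w(2) r _ e1, of "p q - p v"] that True r
        by (auto simp: rgg_adj_def dist_norm norm_minus_commute)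
      ultimately show ?thesis using w(1) by (auto simp: rgg_adj_def)
    qed
  qed (use n in \<open>auto simp: rgg_adj_def dist_commute\<close>)
  moreover have "(\<lambda>x y. rgg_adj n r p x y \<and> x \<in> {..<n} \<and> y \<in> {..<n}) = rgg_adj n r p"
    by (auto simp: rgg_adj_def fun_eq_iff)
  ultimately show "k_cops_win {..<n} (rgg_adj n r p) 1" by simp
qed

lemma cross2_borel_measurable[measurable]:
  assumes [measurable]: "f \<in> borel_measurable M" "g \<in> borel_measurable M"
  shows "(\<lambda>x. cross2 (f x) (g x)) \<in> borel_measurable M"
  unfolding cross2_def cart_eq_inner_axis by measurable

lemma inward_step_measurable[measurable]:
  assumes [measurable]: "f \<in> borel_measurable M" "g \<in> borel_measurable M"
  shows "Measurable.pred M (\<lambda>x. inward_step r (f x) (g x))"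
  unfolding inward_step_def by measurable

text \<open>The rectangle translated to \<open>x\<close> lies inside the square, so its area is its
  probability; \<open>norm (square_centre - x) \<le> 1\<close> bounds this area from below.\<close>

lemma prob_inward_step_ge:
  assumes r: "0 < r" "r < 2 * norm (square_centre - x)" and x: "x \<in> unit_square"
  shows "r ^ 5 / 200 \<le>
    measure (uniform_measure lborel unit_square) {y. inward_step r (square_centre - x) (y - x)}"
proof -
  let ?S = "{y. inward_step r (square_centre - x) (y - x)}"
  let ?T = "{u. inward_step r (square_centre - x) u}"
  have e1: "norm (square_centre - x) \<le> 1" using norm_square_centre_diff_le x by blast
  have e0: "square_centre - x \<noteq> 0" using r by auto
  have sub: "?S \<subseteq> unit_square"
  proof
    fix y assume "y \<in> ?S"
    then have "\<bar>((y - x) - (square_centre - x)) $ i\<bar> \<le> 1 / 2" for i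
      using inward_step_stays_in_square[of r "square_centre - x" "y - x" i] r e1 x
      unfolding mem_unit_square_iff by auto
    then show "y \<in> unit_square" unfolding mem_unit_square_iff by (simp add: abs_minus_commute)
  qed
  have S: "?S \<in> sets borel" by measurable
  have "r ^ 5 / 200 \<le> r ^ 5 / (200 * (norm (square_centre - x))\<^sup>2)"
    using e1 e0 r power_mono[OF e1, of 2] by (intro divide_left_mono) auto
  also have "\<dots> = measure lborel ?T"
    using measure_inward_step[OF r(1) e0] by simp
  also have "\<dots> = measure lborel ?S"
  proof -
    have "measure lborel ?S = measure (distr lborel borel ((+) x)) ?S"
      by (simp add: lborel_distr_plus)
    also have "\<dots> = measure lborel ?T"
      using S by (subst measure_distr) (auto simp: vimage_def)
    finally show ?thesis by simp
  qed
  also have "\<dots> = measure (uniform_measure lborel unit_square) ?S"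
  proof -
    have "unit_square \<inter> ?S = ?S" using sub by auto
    then show ?thesis
      using S
      by (subst measure_uniform_measure)
        (auto simp: emeasure_unit_square measure_def[of lborel unit_square])
  qed
  finally show ?thesis .
qed

subsection \<open>Random geometric graphs\<close>

lemma rgg_point_measurable[measurable]:
  "i < n \<Longrightarrow> (\<lambda>p. p i) \<in> borel_measurable (rgg_space n)"
  using measurable_component_singleton[of i "{..<n}" "\<lambda>_. uniform_measure lborel unit_square"]
  by (simp add: rgg_space_def cong: measurable_cong_sets)

text \<open>There are finitely many graphs on \<open>n\<close> vertices, so the event is a finite
  union of events fixing the whole edge set, whatever \<open>Q\<close> is.\<close>

lemma rgg_graph_property_measurable:
  "{p \<in> space (rgg_space n). Q (rgg_adj n r p)} \<in> sets (rgg_space n)"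
proof -
  let ?V = "{..<n}"
  let ?F = "\<lambda>R. {p \<in> space (rgg_space n). \<forall>i\<in>?V. \<forall>j\<in>?V. (i, j) \<in> R \<longleftrightarrow> rgg_adj n r p i j}"
  have "?F R \<in> sets (rgg_space n)" for R
    unfolding rgg_adj_def by measurable
  moreover have "{p \<in> space (rgg_space n). Q (rgg_adj n r p)} =
      (\<Union>R\<in>{R \<in> Pow (?V \<times> ?V). Q (\<lambda>i j. (i, j) \<in> R)}. ?F R)" (is "?L = ?R")
  proof (intro equalityI subsetI)
    fix p assume p: "p \<in> ?L"
    let ?R' = "{(i, j). rgg_adj n r p i j}"
    have "?R' \<subseteq> ?V \<times> ?V" by (auto simp: rgg_adj_def)
    then show "p \<in> ?R" using p by (intro UN_I[of ?R']) auto
  next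
    fix p assume "p \<in> ?R"
    then obtain R where R: "R \<subseteq> ?V \<times> ?V" "Q (\<lambda>i j. (i, j) \<in> R)" "p \<in> ?F R" by auto
    then have "(\<lambda>i j. (i, j) \<in> R) = rgg_adj n r p"
      by (auto simp: fun_eq_iff rgg_adj_def)
    then show "p \<in> ?L" using R by auto
  qed
  ultimately show ?thesis by auto
qed

text \<open>A union bound over the vertices whose rectangle contains no other point.\<close>

lemma prob_cop_number_rgg_ge:
  assumes n: "n > 0" and r: "r > 0"
  shows "1 - real n * exp (- (r ^ 5 / 200 * real (n - 1))) \<le>
    measure (rgg_space n) {p \<in> space (rgg_space n). cop_number {..<n} (rgg_adj n r p) = 1}"
proof -
  let ?U = "uniform_measure lborel unit_square"
  let ?M = "rgg_space n"
  interpret U: prob_space ?U by (rule prob_space_uniform_square)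
  interpret M: prob_space ?M
    unfolding rgg_space_def by (intro prob_space_PiM prob_space_uniform_square)
  \<comment> \<open>The sample space is the whole plane for each point, which lies in the square
    only almost surely; hence membership is part of \<open>P\<close> and the events are compared up
    to a null set.\<close>
  define P where "P x \<longleftrightarrow> x \<in> unit_square \<and> r < 2 * norm (square_centre - x)" for x
  define D where "D x y \<longleftrightarrow> inward_step r (square_centre - x) (y - x)" for x y
  \<comment> \<open>Leaving out \<open>j = i\<close> loses nothing: displacement 0 is no inward
    step.\<close>
  define Bad where "Bad i = {p \<in> space ?M. P (p i) \<and> (\<forall>j\<in>{..<n} - {i}. \<not> D (p i) (p j))}" for i
  have P: "Measurable.pred borel P"
    unfolding P_def by measurable
  have D: "Measurable.pred (borel \<Otimes>\<^sub>M borel) (\<lambda>z. D (fst z) (snd z))"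
    unfolding D_def by measurable
  have Bad_le: "M.prob (Bad i) \<le> exp (- (r ^ 5 / 200 * real (n - 1)))" if "i < n" for i
  proof -
    have "emeasure ?M (Bad i) \<le> ennreal (exp (- (r ^ 5 / 200 * real (card {..<n} - 1))))"
      unfolding Bad_def rgg_space_def
    proof (rule U.emeasure_PiM_no_related_coordinate_le)
      show "Measurable.pred (?U \<Otimes>\<^sub>M ?U) (\<lambda>z. D (fst z) (snd z))"
        using D by (simp cong: measurable_cong_sets sets_pair_measure_cong)
      show "r ^ 5 / 200 \<le> U.prob {y \<in> space ?U. D x y}" if "P x" for x
        using prob_inward_step_ge[of r x] that r by (simp add: P_def D_def)
    qed (use P that in \<open>simp_all add: pred_def\<close>)
    then show ?thesis by (simp add: M.emeasure_eq_measure)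
  qed
  have Bad_sets: "Bad i \<in> M.events" if "i < n" for i
    unfolding Bad_def P_def D_def using that by measurable
  let ?G = "{p \<in> space ?M. cop_number {..<n} (rgg_adj n r p) = 1}"
  have "AE p in ?M. \<forall>i\<in>{..<n}. p i \<in> unit_square"
    unfolding rgg_space_def
    by (intro AE_finite_allI AE_PiM_component prob_space_uniform_square AE_uniform_measureI)
      auto
  then have "AE p in ?M. p \<in> space ?M - ?G \<longrightarrow> p \<in> (\<Union>i\<in>{..<n}. Bad i)"
  proof eventually_elim
    case (elim p)
    show ?case
    proof (rule impI, rule ccontr)
      assume p: "p \<in> space ?M - ?G" and nb: "p \<notin> (\<Union>i\<in>{..<n}. Bad i)"
      have "cop_number {..<n} (rgg_adj n r p) = 1"
        using elim nb p by (intro cop_number_rgg_eq_1[OF n r]) (auto simp: Bad_def P_def D_def)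
      then show False using p by auto
    qed
  qed
  then have "M.prob (space ?M - ?G) \<le> M.prob (\<Union>i\<in>{..<n}. Bad i)"
    by (rule M.finite_measure_mono_AE) (use Bad_sets in auto)
  also have "\<dots> \<le> (\<Sum>i\<in>{..<n}. M.prob (Bad i))"
    by (rule M.finite_measure_subadditive_finite) (use Bad_sets in auto)
  also have "\<dots> \<le> (\<Sum>i\<in>{..<n}. exp (- (r ^ 5 / 200 * real (n - 1))))"
    by (intro sum_mono Bad_le) auto
  finally show ?thesis
    using M.prob_compl[OF rgg_graph_property_measurable[of n "\<lambda>E. cop_number {..<n} E = 1" r]]
    unfolding sum_constant card_lessThan by linarith
qed

theorem theorem2p1:
  shows "\<exists>c2::real. c2 > 0 \<and>
    (\<forall>r :: nat \<Rightarrow> real.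
       (\<forall>n. r n > 0) \<longrightarrow>
       (\<forall>\<^sub>F n in sequentially. r n ^ 5 > c2 * ln (real n) / real n) \<longrightarrow>
       ((\<lambda>n. measure (rgg_space n)
            {p \<in> space (rgg_space n). cop_number {..<n} (rgg_adj n (r n) p) = 1})
         \<longlonglongrightarrow> 1))"
proof (intro exI[of _ 800] conjI allI impI)
  \<comment> \<open>800 is the product of 200 from the area, 2 from
    \<open>n - 1 \<ge> n / 2\<close>, and 2 to make each bad event have probability at most
    \<open>1 / n\<^sup>2\<close>, so that the union bound leaves \<open>1 / n\<close>.\<close>
  fix r :: "nat \<Rightarrow> real"
  assume r: "\<forall>n. r n > 0" and big: "\<forall>\<^sub>F n in sequentially. r n ^ 5 > 800 * ln (real n) / real n"
  let ?pr = "\<lambda>n. measure (rgg_space n) {p \<in> space (rgg_space n). cop_number {..<n} (rgg_adj n (r n) p) = 1}"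
  show "?pr \<longlonglongrightarrow> 1"
  proof (rule tendsto_sandwich)
    show "\<forall>\<^sub>F n in sequentially. 1 - 1 / real n \<le> ?pr n"
      using big eventually_ge_at_top[of 2]
    proof eventually_elim
      fix n :: nat
      assume n: "2 \<le> n" and rn: "800 * ln (real n) / real n < r n ^ 5"
      \<comment> \<open>For \<open>n \<ge> 2\<close>, \<open>2 * n \<le> 4 * (n - 1)\<close>: this
        absorbs the loss of one point in the exponent.\<close>
      have "2 * ln (real n) * real n \<le> 4 * ln (real n) * real (n - 1)"
        using n by (simp add: of_nat_diff algebra_simps)
      then have "2 * ln (real n) \<le> 4 * ln (real n) / real n * real (n - 1)"
        using n by (simp add: field_simps)
      also have "\<dots> \<le> r n ^ 5 / 200 * real (n - 1)"
        using rn by (intro mult_right_mono) auto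
      finally have "exp (- (r n ^ 5 / 200 * real (n - 1))) \<le> exp (- (2 * ln (real n)))" by simp
      also have "\<dots> = 1 / (real n * real n)"
        using n by (simp add: exp_minus exp_double power2_eq_square field_simps)
      finally have "real n * exp (- (r n ^ 5 / 200 * real (n - 1))) \<le> real n * (1 / (real n * real n))"
        by (rule mult_left_mono) simp
      then show "1 - 1 / real n \<le> ?pr n"
        using prob_cop_number_rgg_ge[of n "r n"] n r by (simp add: order_trans)
    qed
    show "\<forall>\<^sub>F n in sequentially. ?pr n \<le> 1"
      by (intro always_eventually allI prob_space.prob_le_1)
        (simp add: rgg_space_def prob_space_PiM prob_space_uniform_square)
    show "(\<lambda>n. 1 - 1 / real n) \<longlonglongrightarrow> 1" using tendsto_diff[OF tendsto_const lim_1_over_n, of 1] by simp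
  qed simp
qed simp

end
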